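(* Let $k\ge1$ be an integer and let $g_\sigma:\mathbb{R}^n\to\mathbb{R}$ be a $\mathcal{C}^{k+1}$ function with $\nabla g_\sigma$ $L_{g_\sigma}$-Lipschitz, $L_{g_\sigma}<1$. Let $h_\sigma(x):=\frac12\|x\|^2-g_\sigma(x)$ and $D_\sigma:=\mathrm{Id}-\nabla g_\sigma=\nabla h_\sigma$. Then there exist a function $\phi_\sigma:\mathbb{R}^n\to\mathbb{R}\cup\{+\infty\}$ and a constant $K\in\mathbb{R}$ such that: (i) $\phi_\sigma$ is $\frac{L_{g_\sigma}}{L_{g_\sigma}+1}$-weakly convex, $\mathrm{Prox}_{\phi_\sigma}$ is single-valued, and $D_\sigma=\mathrm{Prox}_{\phi_\sigma}$. Moreover $D_\sigma$ is injective, $\mathrm{Im}(D_\sigma)$ is open, and for all $x\in\mathrm{Im}(D_\sigma)$, $$\phi_\sigma(x)=g_\sigma(D_\sigma^{-1}(x))-\tfrac12\|D_\sigma^{-1}(x)-x\|^2+K=h_\sigma^*(x)-\tfrac12\|x\|^2+K .$$ (ii) For all $x\in\mathbb{R}^n$, $\phi_\sigma(x)\ge g_\sigma(x)+K$, and for every fixed point $x$ of $D_\sigma$, $\phi_\sigma(x)=g_\sigma(x)+K$. (iii) $\phi_\sigma$ is $\mathcal{C}^k$ on $\mathrm{Im}(D_\sigma)$ and for all $x\in\mathrm{Im}(D_\sigma)$, $\nabla\phi_\sigma(x)=D_\sigma^{-1}(x)-x=\nabla g_\sigma(D_\sigma^{-1}(x))$. Moreover, $\nabla\phi_\sigma$ is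 $\frac{L_{g_\sigma}}{1-L_{g_\sigma}}$-Lipschitz on $\mathrm{Im}(D_\sigma)$.
   Context: $\|\cdot\|$ is the Euclidean norm. $\mathrm{Prox}_\phi(x)=\arg\min_z\frac12\|x-z\|^2+\phi(z)$. A function $\phi$ is $M$-weakly convex if $\phi+\frac M2\|\cdot\|^2$ is convex. $h^*(x)=\sup_u\langle x,u\rangle-h(u)$ is the convex conjugate. $D_\sigma^{-1}$ denotes the inverse of $D_\sigma$ on $\mathrm{Im}(D_\sigma)$. *)

theory Defs
  imports "HOL-Analysis.Analysis"
begin

(* The definite description is meaningful only where f is differentiable. *)
definition grad :: "('a::real_inner \<Rightarrow> real) \<Rightarrow> 'a \<Rightarrow> 'a" where
  "grad f x = (THE d. GDERIV f x :> d)"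

lemma grad_eqI:
  assumes "GDERIV f x :> d"
  shows "grad f x = d"
  unfolding grad_def
proof (rule the_equality)
  show "GDERIV f x :> d" by fact
next
  fix d' assume "GDERIV f x :> d'"
  with assms have "(\<lambda>h. h \<bullet> d') = (\<lambda>h. h \<bullet> d)"
    unfolding gderiv_def by (rule has_derivative_unique[rotated])
  then show "d' = d"
    by (metis inner_commute vector_eq_rdot)
qed

(* Class C^k on S. The derivatives are full derivatives "at x", so this is meant for open S.
   In finite dimension, continuity of all iterated directional derivatives is equivalent to
   continuity of the iterated Frechet derivatives. *)
primrec Ck_on :: "nat \<Rightarrow> ('a::euclidean_space \<Rightarrow> real) \<Rightarrow> 'a set \<Rightarrow> bool" where
  "Ck_on 0 f S \<longleftrightarrow> continuous_on S f"
| "Ck_on (Suc k) f S \<longleftrightarrow>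
     (\<forall>x\<in>S. f differentiable (at x)) \<and>
     (\<forall>v. Ck_on k (\<lambda>x. frechet_derivative f (at x) v) S)"

(* Meant for functions that never take the value -\<infinity>, so that no sum of opposite infinities
   occurs; the endpoints t = 0 and t = 1 are harmless because 0 * \<infinity> = 0 in ereal. *)
definition ereal_convex :: "('a::real_vector \<Rightarrow> ereal) \<Rightarrow> bool" where
  "ereal_convex F \<longleftrightarrow>
     (\<forall>x y t. 0 \<le> t \<and> t \<le> 1 \<longrightarrow>
        F ((1 - t) *\<^sub>R x + t *\<^sub>R y) \<le> ereal (1 - t) * F x + ereal t * F y)"

definition weakly_convex :: "real \<Rightarrow> ('a::real_normed_vector \<Rightarrow> ereal) \<Rightarrow> bool" where
  "weakly_convex M \<phi> \<longleftrightarrow> ereal_convex (\<lambda>x. \<phi> x + ereal (M / 2 * (norm x)\<^sup>2))"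

(* Set-valued: the set of all minimizers. *)
definition Prox :: "('a::real_normed_vector \<Rightarrow> ereal) \<Rightarrow> 'a \<Rightarrow> 'a set" where
  "Prox \<phi> x = {z. is_arg_min (\<lambda>z. ereal (1 / 2 * (norm (x - z))\<^sup>2) + \<phi> z) (\<lambda>_. True) z}"

definition conjugate :: "('a::real_inner \<Rightarrow> ereal) \<Rightarrow> 'a \<Rightarrow> ereal" where
  "conjugate h x = (SUP u. ereal (x \<bullet> u) - h u)"

end

theory Submission
  imports Defs
begin

text \<open>Write \<open>F\<close> for the gradient of \<open>g\<close>. As \<open>F\<close> is a contraction, the map \<open>D = Id - F\<close> is not merely
  injective: the equation \<open>y - F y = x\<close> has a unique solution for every \<open>x\<close> by Banach's fixed point
  theorem. So \<open>D\<close> is a bijection of the whole space with inverse Lipschitz of constant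
  \<open>1 / (1 - L)\<close>, and \<open>\<phi>\<close>, the convex conjugate of \<open>h\<close> minus half the squared norm, is finite
  everywhere. The constant \<open>K\<close> can be taken to be 0.

  The convex-analytic claims express the duality between smoothness and convexity. The descent inequality
  applied to \<open>g\<close> shows that \<open>h\<close> lies above its tangents, so the conjugate of \<open>h\<close> at \<open>x\<close> is attained
  at the preimage of \<open>x\<close> under \<open>D\<close> (\<open>conjugate_potential\<close>). Applied to \<open>h\<close>, whose gradient \<open>D\<close> is
  \<open>(1 + L)\<close>-Lipschitz, it shows that the conjugate is \<open>1 / (1 + L)\<close>-strongly convex
  (\<open>legendre_strongly_convex\<close>). From this one inequality come the weak convexity of \<open>\<phi>\<close>, the strict
  minimality of \<open>D x\<close> in the proximal problem at \<open>x\<close>, and the differentiability of the conjugate with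
  gradient the inverse of \<open>D\<close>. The bound of \<open>\<phi>\<close> by \<open>g\<close> from below is the Fenchel inequality at the
  pair \<open>(x, x)\<close>.

  For the smoothness of \<open>\<phi>\<close>, its gradient is the inverse of \<open>D\<close> minus the identity, so it is
  enough that the inverse inherits the class of \<open>D\<close>. The derivative of \<open>D\<close> is invertible everywhere
  because \<open>D\<close> is expanding, and Cramer's rule then propagates smoothness to the inverse
  (\<open>Ck_on_inverse_map\<close>).\<close>

section \<open>Calculus of the class of k times continuously differentiable functions\<close>

lemma Ck_on_Suc_has_derivative:
  assumes "Ck_on (Suc k) f S" and "x \<in> S"
  shows "(f has_derivative frechet_derivative f (at x)) (at x)"
  using assms by (simp add: frechet_derivative_works)

lemma Ck_on_imp_continuous_on: "Ck_on k f S \<Longrightarrow> continuous_on S f"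
  by (cases k) (auto intro!: continuous_at_imp_continuous_on differentiable_imp_continuous_within)

lemma Ck_on_SucD: "Ck_on (Suc k) f S \<Longrightarrow> Ck_on k f S"
proof (induction k arbitrary: f)
  case 0
  then show ?case using Ck_on_imp_continuous_on by fastforce
next
  case (Suc k)
  then show ?case by (metis Ck_on.simps(2))
qed

lemma Ck_on_cong:
  assumes "open S" and "\<And>x. x \<in> S \<Longrightarrow> f x = g x" and "Ck_on k f S"
  shows "Ck_on k g S"
  using assms(2,3)
proof (induction k arbitrary: f g)
  case 0
  then show ?case using continuous_on_cong by fastforce
next
  case (Suc k)
  have der: "(g has_derivative frechet_derivative f (at x)) (at x)" if "x \<in> S" for x
    using Ck_on_Suc_has_derivative[OF Suc.prems(2) that] \<open>open S\<close> that Suc.prems(1)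
    by (rule has_derivative_transform_within_open)
  have "Ck_on k (\<lambda>x. frechet_derivative g (at x) v) S" for v
  proof (rule Suc.IH)
    show "Ck_on k (\<lambda>x. frechet_derivative f (at x) v) S"
      using Suc.prems(2) by simp
  qed (metis der frechet_derivative_at)
  with der show ?case by (auto simp: differentiable_def)
qed

text \<open>The recursive definition speaks of \<^const>\<open>frechet_derivative\<close>; a formula for the derivative
  that is valid on an open set is all that is needed to climb one level.\<close>

lemma Ck_on_SucI:
  assumes "open S"
    and der: "\<And>x. x \<in> S \<Longrightarrow> (f has_derivative f' x) (at x)"
    and "\<And>v. Ck_on k (\<lambda>x. f' x v) S"
  shows "Ck_on (Suc k) f S"
proof -
  have "Ck_on k (\<lambda>x. frechet_derivative f (at x) v) S" for v
    by (rule Ck_on_cong[OF assms(1) _ assms(3)[of v]]) (metis der frechet_derivative_at)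
  with der show ?thesis by (auto simp: differentiable_def)
qed

lemma Ck_on_const: "open S \<Longrightarrow> Ck_on k (\<lambda>x. c) S"
proof (induction k arbitrary: c)
  case (Suc k)
  show ?case
    by (rule Ck_on_SucI[OF Suc.prems has_derivative_const Suc.IH[OF Suc.prems]])
qed simp

lemma Ck_on_inner_right: "open S \<Longrightarrow> Ck_on k (\<lambda>x. x \<bullet> c) S"
proof (cases k)
  case (Suc m)
  assume "open S"
  then show ?thesis unfolding Suc
    by (intro Ck_on_SucI[where f' = "\<lambda>x v. v \<bullet> c"] Ck_on_const) (auto intro!: derivative_eq_intros)
qed (auto intro!: continuous_intros)

lemma Ck_on_add:
  assumes "open S" and "Ck_on k f S" and "Ck_on k g S"
  shows "Ck_on k (\<lambda>x. f x + g x) S"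
  using assms(2,3)
proof (induction k arbitrary: f g)
  case 0
  then show ?case by (auto intro!: continuous_intros)
next
  case (Suc k)
  show ?case
  proof (rule Ck_on_SucI[OF assms(1)])
    show "((\<lambda>x. f x + g x) has_derivative
        (\<lambda>v. frechet_derivative f (at x) v + frechet_derivative g (at x) v)) (at x)"
      if "x \<in> S" for x
      using that Suc.prems by (intro has_derivative_add Ck_on_Suc_has_derivative)
    show "Ck_on k (\<lambda>x. frechet_derivative f (at x) v + frechet_derivative g (at x) v) S" for v
      by (rule Suc.IH) (use Suc.prems in auto)
  qed
qed

lemma Ck_on_mult:
  assumes "open S" and "Ck_on k f S" and "Ck_on k g S"
  shows "Ck_on k (\<lambda>x. f x * g x) S"
  using assms(2,3)
proof (induction k arbitrary: f g)
  case 0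
  then show ?case by (auto intro!: continuous_intros)
next
  case (Suc k)
  show ?case
  proof (rule Ck_on_SucI[OF assms(1)])
    show "((\<lambda>x. f x * g x) has_derivative
        (\<lambda>v. f x * frechet_derivative g (at x) v + frechet_derivative f (at x) v * g x)) (at x)"
      if "x \<in> S" for x
      using that Suc.prems by (intro has_derivative_mult Ck_on_Suc_has_derivative)
    show "Ck_on k (\<lambda>x. f x * frechet_derivative g (at x) v + frechet_derivative f (at x) v * g x) S"
      for v
      using Suc.prems Suc.prems[THEN Ck_on_SucD]
      by (intro Ck_on_add[OF assms(1)] Suc.IH) auto
  qed
qed

lemma Ck_on_diff:
  assumes "open S" and "Ck_on k f S" and "Ck_on k g S"
  shows "Ck_on k (\<lambda>x. f x - g x) S"
  using Ck_on_add[OF assms(1,2) Ck_on_mult[OF assms(1) Ck_on_const[OF assms(1), of k "-1"] assms(3)]]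
  by simp

lemma Ck_on_sum:
  assumes "open S" and "\<And>i. i \<in> I \<Longrightarrow> Ck_on k (f i) S"
  shows "Ck_on k (\<lambda>x. \<Sum>i\<in>I. f i x) S"
  using assms(2)
  by (induction I rule: infinite_finite_induct)
    (simp_all add: Ck_on_const Ck_on_add assms(1) del: Ck_on.simps)

lemma Ck_on_prod:
  assumes "open S" and "\<And>i. i \<in> I \<Longrightarrow> Ck_on k (f i) S"
  shows "Ck_on k (\<lambda>x. \<Prod>i\<in>I. f i x) S"
  using assms(2)
  by (induction I rule: infinite_finite_induct)
    (simp_all add: Ck_on_const Ck_on_mult assms(1) del: Ck_on.simps)

lemma Ck_on_inverse:
  assumes "open S" and "Ck_on k f S" and nz: "\<And>x. x \<in> S \<Longrightarrow> f x \<noteq> 0"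
  shows "Ck_on k (\<lambda>x. inverse (f x)) S"
  using assms(2)
proof (induction k)
  case 0
  then show ?case using nz by (auto intro!: continuous_intros)
next
  case (Suc k)
  show ?case
  proof (rule Ck_on_SucI[OF assms(1)])
    show "((\<lambda>x. inverse (f x)) has_derivative
        (\<lambda>v. - (inverse (f x) * frechet_derivative f (at x) v * inverse (f x)))) (at x)"
      if "x \<in> S" for x
      using that Suc.prems nz by (intro Deriv.has_derivative_inverse Ck_on_Suc_has_derivative)
    have inv: "Ck_on k (\<lambda>x. inverse (f x)) S"
      by (rule Suc.IH[OF Ck_on_SucD[OF Suc.prems]])
    have "Ck_on k (\<lambda>x. 0 - inverse (f x) * frechet_derivative f (at x) v * inverse (f x)) S" for v
      using Suc.prems inv
      by (intro Ck_on_diff[OF assms(1)] Ck_on_mult[OF assms(1)] Ck_on_const[OF assms(1)]) auto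
    then show "Ck_on k (\<lambda>x. - (inverse (f x) * frechet_derivative f (at x) v * inverse (f x))) S" for v
      by simp
  qed
qed

lemma Ck_on_det:
  fixes A :: "'a::euclidean_space \<Rightarrow> real^'n^'n"
  assumes "open S" and "\<And>i j. Ck_on k (\<lambda>x. A x $ i $ j) S"
  shows "Ck_on k (\<lambda>x. det (A x)) S"
  unfolding det_def
  by (intro Ck_on_sum Ck_on_mult Ck_on_prod Ck_on_const assms)

text \<open>By the chain rule the partial derivatives of a composition are polynomials in those of the
  inner map and in the partial derivatives of the outer function composed with the inner map, so
  the order of differentiability can be raised one step at a time.\<close>

lemma Ck_on_compose:
  fixes f :: "'b::euclidean_space \<Rightarrow> real" and E :: "'a::euclidean_space \<Rightarrow> 'b"
  assumes "open S" and "E ` S \<subseteq> T" and "Ck_on k f T"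
    and "\<And>b. b \<in> Basis \<Longrightarrow> Ck_on k (\<lambda>x. E x \<bullet> b) S"
  shows "Ck_on k (\<lambda>x. f (E x)) S"
  using assms(3,4)
proof (induction k arbitrary: f)
  case 0
  then have "continuous_on S E"
    by (auto intro: continuous_on_componentwise[THEN iffD2])
  with 0 assms(2) show ?case
    by (auto intro: continuous_on_compose2)
next
  case (Suc k)
  define E' where "E' x v = (\<Sum>b\<in>Basis. frechet_derivative (\<lambda>x. E x \<bullet> b) (at x) v *\<^sub>R b)" for x v
  have E': "(E has_derivative E' x) (at x)" if "x \<in> S" for x
  proof (subst has_derivative_componentwise_within, intro ballI)
    fix b :: 'b assume b: "b \<in> Basis"
    have "(\<lambda>v. E' x v \<bullet> b) = frechet_derivative (\<lambda>x. E x \<bullet> b) (at x)"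
      using b by (simp add: E'_def)
    then show "((\<lambda>x. E x \<bullet> b) has_derivative (\<lambda>v. E' x v \<bullet> b)) (at x)"
      using Ck_on_Suc_has_derivative[OF Suc.prems(2)[OF b] that] by simp
  qed
  show ?case
  proof (rule Ck_on_SucI[OF assms(1)])
    fix x assume x: "x \<in> S"
    have f': "(f has_derivative frechet_derivative f (at (E x))) (at (E x))"
      using x assms(2) by (intro Ck_on_Suc_has_derivative[OF Suc.prems(1)]) auto
    interpret f': linear "frechet_derivative f (at (E x))"
      using f' has_derivative_linear by blast
    have "((\<lambda>x. f (E x)) has_derivative (\<lambda>v. frechet_derivative f (at (E x)) (E' x v))) (at x)"
      by (rule has_derivative_compose[OF E'[OF x] f'])
    also have "(\<lambda>v. frechet_derivative f (at (E x)) (E' x v)) =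
      (\<lambda>v. \<Sum>b\<in>Basis. frechet_derivative (\<lambda>x. E x \<bullet> b) (at x) v * frechet_derivative f (at (E x)) b)"
      by (simp add: E'_def f'.sum f'.scale)
    finally show "((\<lambda>x. f (E x)) has_derivative (\<lambda>v. \<Sum>b\<in>Basis.
      frechet_derivative (\<lambda>x. E x \<bullet> b) (at x) v * frechet_derivative f (at (E x)) b)) (at x)" .
  next
    have "Ck_on k (\<lambda>x. frechet_derivative f (at (E x)) b) S" for b
    proof (rule Suc.IH)
      show "Ck_on k (\<lambda>y. frechet_derivative f (at y) b) T"
        using Suc.prems(1) by simp
    qed (rule Ck_on_SucD[OF Suc.prems(2)])
    then show "Ck_on k (\<lambda>x. \<Sum>b\<in>Basis.
      frechet_derivative (\<lambda>x. E x \<bullet> b) (at x) v * frechet_derivative f (at (E x)) b) S" for v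
      using Suc.prems by (intro Ck_on_sum Ck_on_mult assms(1)) auto
  qed
qed

section \<open>Smoothness of an inverse map\<close>

text \<open>The derivative of the inverse \<open>E\<close> of \<open>D\<close> at \<open>x\<close> in direction \<open>v\<close> solves the linear system with
  matrix \<open>D' (E x)\<close> and right-hand side \<open>v\<close>. Cramer's rule expresses it as a quotient of
  polynomials in the partial derivatives of \<open>D\<close> composed with \<open>E\<close>. So if \<open>E\<close> is of class m then
  its partial derivatives are too, and \<open>E\<close> is of class m + 1.\<close>

lemma Ck_on_inverse_map:
  fixes D E :: "real^'n \<Rightarrow> real^'n"
  assumes "open T" and "continuous_on T E" and ET: "E ` T \<subseteq> S"
    and DE: "\<And>x. x \<in> T \<Longrightarrow> D (E x) = x"
    and D': "\<And>y. y \<in> S \<Longrightarrow> (D has_derivative D' y) (at y)"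
    and inj: "\<And>y. y \<in> S \<Longrightarrow> inj (D' y)"
    and D_Ck: "\<And>i. Ck_on k (\<lambda>y. D y $ i) S"
  shows "Ck_on k (\<lambda>x. E x $ i) T"
  using D_Ck
proof (induction k arbitrary: i)
  case 0
  show ?case using assms(2) by (auto intro!: continuous_intros)
next
  case (Suc k)
  define A where "A x = matrix (D' (E x))" for x
  define sol where "sol x v = (\<chi> k. det (\<chi> i j. if j = k then v $ i else A x $ i $ j) / det (A x))"
    for x v
  have lin: "linear (D' y)" if "y \<in> S" for y
    using D'[OF that] has_derivative_linear by blast
  have det: "det (A x) \<noteq> 0" if "x \<in> T" for x
    using that ET unfolding A_def by (subst det_nz_iff_inj) (auto intro: lin inj)
  \<comment> \<open>\<open>sol x v\<close> is the solution by Cramer's rule, hence \<open>sol x\<close> inverts \<open>D' (E x)\<close>.\<close>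
  have sol: "D' (E x) w = v \<longleftrightarrow> w = sol x v" if "x \<in> T" for x w v
  proof -
    have "A x *v w = D' (E x) w"
      using lin[of "E x"] ET that by (simp add: A_def image_subset_iff)
    then show ?thesis
      using cramer[OF det[OF that], of w v] by (simp add: sol_def)
  qed
  have E': "(E has_derivative sol x) (at x)" if x: "x \<in> T" for x
  proof (rule has_derivative_inverse_basic)
    show "(D has_derivative D' (E x)) (at (E x))"
      using D' ET x by auto
    interpret D': linear "D' (E x)" using lin ET x by auto
    have "linear (sol x)"
      by (rule linearI) (metis D'.add D'.scale sol x)+
    then show "bounded_linear (sol x)"
      by (simp add: linear_conv_bounded_linear)
    show "sol x \<circ> D' (E x) = id"
      using sol[OF x] by (metis comp_apply eq_id_iff)
    show "continuous (at x) E"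
      using assms(1,2) x continuous_on_eq_continuous_at by blast
  qed (use assms(1) x DE in auto)
  have E_Ck: "Ck_on k (\<lambda>x. E x $ i) T" for i
    by (rule Suc.IH[OF Ck_on_SucD[OF Suc.prems]])
  have entries: "Ck_on k (\<lambda>x. A x $ i $ j) T" for i j
  proof (rule Ck_on_cong[OF assms(1)])
    show "Ck_on k (\<lambda>x. frechet_derivative (\<lambda>y. D y $ i) (at (E x)) (axis j 1)) T"
    proof (rule Ck_on_compose[OF assms(1) ET])
      show "Ck_on k (\<lambda>y. frechet_derivative (\<lambda>y. D y $ i) (at y) (axis j 1)) S"
        using Suc.prems by auto
      show "Ck_on k (\<lambda>x. E x \<bullet> b) T" if "b \<in> Basis" for b
        using that E_Ck by (auto simp: Basis_vec_def inner_axis)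
    qed
    fix x assume "x \<in> T"
    then have "((\<lambda>y. D y $ i) has_derivative (\<lambda>v. D' (E x) v $ i)) (at (E x))"
      using ET D' by (intro bounded_linear.has_derivative[OF bounded_linear_vec_nth]) auto
    then show "frechet_derivative (\<lambda>y. D y $ i) (at (E x)) (axis j 1) = A x $ i $ j"
      by (simp add: frechet_derivative_at[symmetric] A_def matrix_def)
  qed
  show ?case
  proof (rule Ck_on_SucI[OF assms(1)])
    show "((\<lambda>x. E x $ i) has_derivative (\<lambda>v. sol x v $ i)) (at x)" if "x \<in> T" for x
      by (rule bounded_linear.has_derivative[OF bounded_linear_vec_nth E'[OF that]])
    have entries': "Ck_on k (\<lambda>x. (\<chi> l j. if j = i then v $ l else A x $ l $ j) $ l $ j) T" for v l j
      using entries by (cases "j = i") (simp_all add: Ck_on_const[OF assms(1)] del: Ck_on.simps)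
    show "Ck_on k (\<lambda>x. sol x v $ i) T" for v
      unfolding sol_def vec_lambda_beta divide_inverse
      by (intro Ck_on_mult Ck_on_inverse Ck_on_det entries entries' assms(1) det)
  qed
qed

section \<open>Estimates for functions with Lipschitz gradient\<close>

text \<open>Along the segment from \<open>x\<close> to \<open>y\<close> the slope of \<open>f\<close> exceeds its initial value by at most
  the Lipschitz constant times the distance travelled.\<close>

lemma descent_inequality:
  fixes f :: "'a::real_inner \<Rightarrow> real"
  assumes "\<And>x. GDERIV f x :> F x" and "M-lipschitz_on UNIV F"
  shows "f y \<le> f x + F x \<bullet> (y - x) + M / 2 * (norm (y - x))\<^sup>2"
proof -
  define d where "d = y - x"
  define q where "q t = f (x + t *\<^sub>R d) - t * (F x \<bullet> d) - M / 2 * t\<^sup>2 * (norm d)\<^sup>2" for t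
  have f': "(f has_derivative (\<lambda>v. v \<bullet> F z)) (at z)" for z
    using assms(1) by (simp add: gderiv_def)
  have path: "((\<lambda>t. x + t *\<^sub>R d) has_derivative (\<lambda>s. s *\<^sub>R d)) (at t)" for t
    by (auto intro!: derivative_eq_intros)
  have q': "(q has_real_derivative (F (x + t *\<^sub>R d) - F x) \<bullet> d - M * t * (norm d)\<^sup>2) (at t)" for t
  proof -
    have "((\<lambda>t. f (x + t *\<^sub>R d)) has_derivative (\<lambda>s. (s *\<^sub>R d) \<bullet> F (x + t *\<^sub>R d))) (at t)"
      by (rule has_derivative_compose[OF path f'])
    then have "((\<lambda>t. f (x + t *\<^sub>R d)) has_real_derivative d \<bullet> F (x + t *\<^sub>R d)) (at t)"
      by (rule has_derivative_imp_has_field_derivative) (simp add: mult.commute)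
    then show ?thesis
      unfolding q_def
      by (auto intro!: derivative_eq_intros simp: inner_diff_left inner_diff_right inner_commute)
  qed
  have "(F (x + t *\<^sub>R d) - F x) \<bullet> d - M * t * (norm d)\<^sup>2 \<le> 0" if "0 \<le> t" for t
  proof -
    have "(F (x + t *\<^sub>R d) - F x) \<bullet> d \<le> norm (F (x + t *\<^sub>R d) - F x) * norm d"
      by (rule norm_cauchy_schwarz)
    also have "\<dots> \<le> (M * norm (t *\<^sub>R d)) * norm d"
      using lipschitz_on_normD[OF assms(2), of "x + t *\<^sub>R d" x] by (intro mult_right_mono) auto
    finally show ?thesis
      using that by (simp add: power2_eq_square mult.assoc)
  qed
  with q' have "q 1 \<le> q 0"
    by (intro DERIV_nonpos_imp_nonincreasing[of 0 1 q]) (simp, meson)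
  then show ?thesis
    by (simp add: q_def d_def)
qed

text \<open>An expanding map has an injective derivative, since a direction killed by the derivative
  would be one in which the map moves points too little.\<close>

lemma inj_derivative_of_expanding_map:
  fixes f :: "'a::real_normed_vector \<Rightarrow> 'b::real_normed_vector"
  assumes f': "(f has_derivative f') (at x)" and "0 < m"
    and expand: "\<And>y. m * norm (y - x) \<le> norm (f y - f x)"
  shows "inj f'"
proof -
  interpret f': linear f' using f' has_derivative_linear by blast
  have "v = 0" if "f' v = 0" for v
  proof (rule ccontr)
    assume "v \<noteq> 0"
    obtain d where "d > 0"
      and d: "\<And>y. norm (y - x) < d \<Longrightarrow> norm (f y - f x - f' (y - x)) \<le> m / 2 * norm (y - x)"
      using f' \<open>0 < m\<close> unfolding has_derivative_at_alt by (metis half_gt_zero)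
    \<comment> \<open>The step along \<open>v\<close> has length \<open>d / 2\<close>, within reach of the linearisation estimate.\<close>
    define t where "t = d / (2 * norm v)"
    have t: "0 < t" "norm (t *\<^sub>R v) < d"
      using \<open>v \<noteq> 0\<close> \<open>d > 0\<close> by (auto simp: t_def)
    have "m * norm (t *\<^sub>R v) \<le> m / 2 * norm (t *\<^sub>R v)"
      using expand[of "x + t *\<^sub>R v"] d[of "x + t *\<^sub>R v"] t that by (simp add: f'.scale)
    then show False
      using t \<open>v \<noteq> 0\<close> \<open>0 < m\<close> by simp
  qed
  then show ?thesis
    by (simp add: f'.inj_iff_eq_0 linear_injective_0[OF f'.linear_axioms])
qed

text \<open>Average the subgradient inequalities at the combined point; the linear terms cancel.\<close>

lemma convex_combination_le_of_subgradient:
  fixes \<psi> :: "'a::real_inner \<Rightarrow> real"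
  assumes sub: "\<And>x z. \<psi> x + p x \<bullet> (z - x) \<le> \<psi> z" and "0 \<le> t" and "t \<le> 1"
  shows "\<psi> ((1 - t) *\<^sub>R x + t *\<^sub>R y) \<le> (1 - t) * \<psi> x + t * \<psi> y"
proof -
  define z where "z = (1 - t) *\<^sub>R x + t *\<^sub>R y"
  have "(1 - t) * (\<psi> z + p z \<bullet> (x - z)) + t * (\<psi> z + p z \<bullet> (y - z)) \<le> (1 - t) * \<psi> x + t * \<psi> y"
    using sub[of z] assms(2,3) by (intro add_mono mult_left_mono) auto
  moreover have "(1 - t) * (\<psi> z + p z \<bullet> (x - z)) + t * (\<psi> z + p z \<bullet> (y - z)) = \<psi> z"
    by (simp add: z_def inner_diff_right inner_add_right algebra_simps)
  ultimately show ?thesis by (simp add: z_def)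
qed

lemma norm_diff_square_expand:
  fixes u y :: "'a::real_inner"
  shows "(norm u)\<^sup>2 = (norm y)\<^sup>2 + 2 * (y \<bullet> (u - y)) + (norm (u - y))\<^sup>2"
  unfolding power2_norm_eq_inner by (simp add: algebra_simps inner_commute)

section \<open>Gradient-step denoisers\<close>

locale contractive_gradient =
  fixes g :: "'a::euclidean_space \<Rightarrow> real" and F :: "'a \<Rightarrow> 'a" and L :: real
  assumes gderiv: "\<And>x. GDERIV g x :> F x"
    and lip: "L-lipschitz_on UNIV F"
    and L_less_1: "L < 1"
begin

definition denoiser :: "'a \<Rightarrow> 'a" where "denoiser x = x - F x"

definition potential :: "'a \<Rightarrow> real" where "potential x = 1 / 2 * (norm x)\<^sup>2 - g x"

text \<open>This is the Legendre transform of the potential: the supremum of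
  \<open>x \<bullet> u - potential u\<close> over \<open>u\<close> is attained where the gradient of the potential is \<open>x\<close>.\<close>

definition legendre :: "'a \<Rightarrow> real" where
  "legendre x = x \<bullet> inv denoiser x - potential (inv denoiser x)"

lemma L_nonneg: "0 \<le> L"
  using lip by (rule lipschitz_on_nonneg)

lemma gderiv_potential: "GDERIV potential x :> denoiser x"
proof -
  have "((\<lambda>x. 1 / 2 * (norm x)\<^sup>2 - g x) has_derivative (\<lambda>v. v \<bullet> x - v \<bullet> F x)) (at x)"
    unfolding power2_norm_eq_inner
    by (auto intro!: derivative_eq_intros gderiv[unfolded gderiv_def] simp: inner_commute fun_eq_iff)
  then show ?thesis
    by (simp add: gderiv_def potential_def[abs_def] denoiser_def inner_diff_right)
qed

lemma lipschitz_denoiser: "(1 + L)-lipschitz_on UNIV denoiser"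
  unfolding denoiser_def[abs_def]
  by (intro lipschitz_on_diff lipschitz_on_id lip)

lemma denoiser_expanding: "(1 - L) * norm (y - z) \<le> norm (denoiser y - denoiser z)"
proof -
  have "norm (y - z) \<le> norm (denoiser y - denoiser z) + norm (F y - F z)"
    using norm_triangle_ineq[of "denoiser y - denoiser z" "F y - F z"]
    by (simp add: denoiser_def algebra_simps)
  moreover have "norm (F y - F z) \<le> L * norm (y - z)"
    using lipschitz_on_normD[OF lip] by simp
  ultimately show ?thesis by (simp add: algebra_simps)
qed

lemma inj_denoiser: "inj denoiser"
proof (rule injI)
  fix y z assume "denoiser y = denoiser z"
  then have "(1 - L) * norm (y - z) \<le> 0"
    using denoiser_expanding[of y z] by simp
  then show "y = z"
    using L_less_1 by (simp add: mult_le_0_iff)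
qed

text \<open>Solving \<open>denoiser y = x\<close> means finding a fixed point of the contraction \<open>y \<mapsto> x + F y\<close>.\<close>

lemma surj_denoiser: "surj denoiser"
  unfolding surj_def
proof
  fix x
  have "\<exists>!y. y \<in> UNIV \<and> x + F y = y"
  proof (rule Banach_fix[OF complete_UNIV _ L_nonneg L_less_1])
    show "dist (x + F y) (x + F z) \<le> L * dist y z" for y z
      using lipschitz_onD[OF lip] by simp
  qed auto
  then obtain y where "x + F y = y" by auto
  then show "\<exists>y. x = denoiser y"
    by (metis add_diff_cancel_right' denoiser_def)
qed

lemma denoiser_inv [simp]: "denoiser (inv denoiser x) = x"
  by (rule surj_f_inv_f[OF surj_denoiser])

lemma inv_denoiser [simp]: "inv denoiser (denoiser x) = x"
  by (rule inv_f_f[OF inj_denoiser])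

lemma lipschitz_inv_denoiser: "(1 / (1 - L))-lipschitz_on UNIV (inv denoiser)"
proof (rule lipschitz_onI)
  fix x z
  have "(1 - L) * norm (inv denoiser x - inv denoiser z) \<le> norm (x - z)"
    using denoiser_expanding[of "inv denoiser x" "inv denoiser z"] by simp
  then show "dist (inv denoiser x) (inv denoiser z) \<le> 1 / (1 - L) * dist x z"
    using L_less_1 by (simp add: dist_norm field_simps)
qed (use L_less_1 in auto)

text \<open>The descent inequality bounds the linearisation error of \<open>g\<close> by \<open>L / 2\<close> times the squared
  distance, which the quadratic part of the potential outweighs.\<close>

lemma potential_ge_tangent: "potential y + denoiser y \<bullet> (u - y) \<le> potential u"
proof -
  have "L * (norm (u - y))\<^sup>2 \<le> 1 * (norm (u - y))\<^sup>2"
    using L_less_1 by (intro mult_right_mono) auto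
  then show ?thesis
    using descent_inequality[OF gderiv lip, of u y] norm_diff_square_expand[of u y]
    unfolding potential_def denoiser_def inner_diff_left by argo
qed

lemma legendre_ge: "x \<bullet> u - potential u \<le> legendre x"
  using potential_ge_tangent[of "inv denoiser x" u] by (simp add: legendre_def inner_diff_right)

lemma conjugate_potential: "conjugate (\<lambda>u. ereal (potential u)) x = ereal (legendre x)"
  unfolding conjugate_def
proof (rule antisym)
  show "(SUP u. ereal (x \<bullet> u) - ereal (potential u)) \<le> ereal (legendre x)"
    by (rule SUP_least) (simp add: legendre_ge)
  show "ereal (legendre x) \<le> (SUP u. ereal (x \<bullet> u) - ereal (potential u))"
    by (rule SUP_upper2[of "inv denoiser x"]) (simp_all add: legendre_def)
qed

text \<open>Smoothness of the potential turns into strong convexity of its conjugate. In the supremum that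
  defines the conjugate at \<open>z\<close>, the quadratic upper bound of the potential around the point
  \<open>inv denoiser x\<close> is optimised by moving \<open>(z - x) / (1 + L)\<close> away from that point.\<close>

lemma legendre_strongly_convex:
  "legendre x + inv denoiser x \<bullet> (z - x) + (norm (z - x))\<^sup>2 / (2 * (1 + L)) \<le> legendre z"
proof -
  define y where "y = inv denoiser x"
  define d where "d = z - x"
  define c where "c = 1 + L"
  define u where "u = y + d /\<^sub>R c"
  define q where "q = (norm d)\<^sup>2 / (2 * c)"
  have "potential u \<le> potential y + x \<bullet> (u - y) + c / 2 * (norm (u - y))\<^sup>2"
    using descent_inequality[OF gderiv_potential lipschitz_denoiser, of u y]
    by (simp add: y_def c_def)
  also have "c / 2 * (norm (u - y))\<^sup>2 = q"
    by (simp add: u_def q_def power_mult_distrib power2_eq_square field_simps)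
  also have "x \<bullet> (u - y) = (x \<bullet> d) / c"
    by (simp add: u_def divide_inverse)
  finally have "potential u \<le> potential y + (x \<bullet> d) / c + q" .
  moreover have "z \<bullet> u = z \<bullet> y + (x \<bullet> d) / c + 2 * q"
  proof -
    have "z \<bullet> d = x \<bullet> d + (norm d)\<^sup>2"
      by (simp add: d_def power2_norm_eq_inner algebra_simps)
    moreover have "z \<bullet> u = z \<bullet> y + (z \<bullet> d) / c"
      by (simp add: u_def inner_add_right divide_inverse mult.commute)
    ultimately show ?thesis
      by (simp add: q_def add_divide_distrib)
  qed
  moreover have "z \<bullet> y = x \<bullet> y + y \<bullet> d"
    by (simp add: d_def inner_diff_right inner_commute)
  ultimately have "x \<bullet> y - potential y + y \<bullet> d + q \<le> z \<bullet> u - potential u"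
    by linarith
  also have "\<dots> \<le> legendre z" by (rule legendre_ge)
  finally show ?thesis by (simp only: legendre_def y_def d_def q_def c_def)
qed

lemma legendre_ge_tangent: "legendre x + inv denoiser x \<bullet> (z - x) \<le> legendre z"
proof -
  have "0 \<le> (norm (z - x))\<^sup>2 / (2 * (1 + L))" using L_nonneg by simp
  then show ?thesis using legendre_strongly_convex[of x z] by linarith
qed

text \<open>The tangent inequalities at \<open>x\<close> and at \<open>z\<close> confine the linearisation error between 0 and
  \<open>(inv denoiser z - inv denoiser x) \<bullet> (z - x)\<close>, which is of second order because the inverse of
  the denoiser is Lipschitz.\<close>

lemma gderiv_legendre: "GDERIV legendre x :> inv denoiser x"
  unfolding gderiv_def has_derivative_at_alt
proof (intro conjI allI impI)
  show "bounded_linear (\<lambda>v. v \<bullet> inv denoiser x)"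
    by (rule bounded_linear_inner_left)
  fix e :: real assume "0 < e"
  show "\<exists>d>0. \<forall>z. norm (z - x) < d \<longrightarrow>
    norm (legendre z - legendre x - (z - x) \<bullet> inv denoiser x) \<le> e * norm (z - x)"
  proof (intro exI[of _ "e * (1 - L)"] conjI allI impI)
    show "0 < e * (1 - L)" using \<open>0 < e\<close> L_less_1 by simp
    fix z assume z: "norm (z - x) < e * (1 - L)"
    have "legendre z - legendre x - (z - x) \<bullet> inv denoiser x
        \<le> (inv denoiser z - inv denoiser x) \<bullet> (z - x)"
      using legendre_ge_tangent[of z x] by (simp add: algebra_simps inner_commute)
    also have "\<dots> \<le> norm (inv denoiser z - inv denoiser x) * norm (z - x)"
      by (rule norm_cauchy_schwarz)
    also have "\<dots> \<le> e * norm (z - x)"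
    proof (rule mult_right_mono)
      have "norm (inv denoiser z - inv denoiser x) \<le> 1 / (1 - L) * norm (z - x)"
        using lipschitz_on_normD[OF lipschitz_inv_denoiser] by simp
      also have "\<dots> \<le> e"
        using z L_less_1 by (simp add: field_simps)
      finally show "norm (inv denoiser z - inv denoiser x) \<le> e" .
    qed simp
    finally show "norm (legendre z - legendre x - (z - x) \<bullet> inv denoiser x) \<le> e * norm (z - x)"
      using legendre_ge_tangent[of x z] by (simp add: inner_commute)
  qed
qed

text \<open>The function whose proximal map is the denoiser; half the squared norm is subtracted because
  it reappears in the proximal objective.\<close>

definition regularizer :: "'a \<Rightarrow> real" where
  "regularizer x = legendre x - 1 / 2 * (norm x)\<^sup>2"

lemma regularizer_eq:
  "regularizer x = g (inv denoiser x) - 1 / 2 * (norm (inv denoiser x - x))\<^sup>2"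
  unfolding regularizer_def legendre_def potential_def power2_norm_eq_inner
  by (simp add: algebra_simps inner_commute)

text \<open>This is the Fenchel inequality with the same point on the primal and the dual side.\<close>

lemma regularizer_ge: "g x \<le> regularizer x"
  using legendre_ge[of x x] by (simp add: regularizer_def potential_def power2_norm_eq_inner)

lemma inv_denoiser_diff: "inv denoiser x - x = F (inv denoiser x)"
  using denoiser_inv[of x] by (simp add: denoiser_def algebra_simps)

lemma gderiv_regularizer: "GDERIV regularizer x :> inv denoiser x - x"
proof -
  have "((\<lambda>x. legendre x - 1 / 2 * (norm x)\<^sup>2) has_derivative
      (\<lambda>v. v \<bullet> inv denoiser x - v \<bullet> x)) (at x)"
    unfolding power2_norm_eq_inner
    by (auto intro!: derivative_eq_intros gderiv_legendre[unfolded gderiv_def]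
        simp: inner_commute fun_eq_iff)
  then show ?thesis
    by (simp add: gderiv_def regularizer_def[abs_def] inner_diff_right)
qed

text \<open>Since \<open>L / (L + 1) = 1 - 1 / (1 + L)\<close>, adding the quadratic term leaves the Legendre
  transform minus exactly the quadratic that its strong convexity absorbs.\<close>

lemma weakly_convex_regularizer: "weakly_convex (L / (L + 1)) (\<lambda>x. ereal (regularizer x))"
proof -
  define \<psi> where "\<psi> x = regularizer x + L / (L + 1) / 2 * (norm x)\<^sup>2" for x
  have pos: "0 < 1 + L" using L_nonneg by simp
  have \<psi>: "\<psi> x = legendre x - (norm x)\<^sup>2 / (2 * (1 + L))" for x
    using pos by (simp add: \<psi>_def regularizer_def field_simps)
  have "\<psi> x + (inv denoiser x - x /\<^sub>R (1 + L)) \<bullet> (z - x) \<le> \<psi> z" for x z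
  proof -
    have "(norm z)\<^sup>2 / (2 * c) =
        (norm x)\<^sup>2 / (2 * c) + (x \<bullet> (z - x)) / c + (norm (z - x))\<^sup>2 / (2 * c)" for c
      unfolding norm_diff_square_expand[of z x] by (simp add: add_divide_distrib)
    note this[of "1 + L"]
    moreover have "(inv denoiser x - x /\<^sub>R (1 + L)) \<bullet> (z - x) =
        inv denoiser x \<bullet> (z - x) - (x \<bullet> (z - x)) / (1 + L)"
      by (simp add: inner_diff_left divide_inverse mult.commute)
    ultimately show ?thesis
      using legendre_strongly_convex[of x z] unfolding \<psi> by linarith
  qed
  from convex_combination_le_of_subgradient[where \<psi> = \<psi>, OF this] show ?thesis
    by (simp add: weakly_convex_def ereal_convex_def \<psi>_def)
qed

text \<open>Up to the constant \<open>(norm x)\<^sup>2 / 2\<close>, the proximal objective at \<open>x\<close> is the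
  Legendre transform minus the linear function \<open>z \<mapsto> x \<bullet> z\<close>; it is strongly convex and its
  gradient \<open>inv denoiser z - x\<close> vanishes exactly at \<open>z = denoiser x\<close>.\<close>

lemma Prox_regularizer: "Prox (\<lambda>x. ereal (regularizer x)) x = {denoiser x}"
proof -
  define obj where "obj z = 1 / 2 * (norm (x - z))\<^sup>2 + regularizer z" for z
  have obj: "obj z = (norm x)\<^sup>2 / 2 - x \<bullet> z + legendre z" for z
    unfolding obj_def regularizer_def power2_norm_eq_inner
    by (simp add: algebra_simps inner_commute)
  have min: "obj (denoiser x) + (norm (z - denoiser x))\<^sup>2 / (2 * (1 + L)) \<le> obj z" for z
    using legendre_strongly_convex[of "denoiser x" z] by (simp add: obj inner_diff_right)
  have less: "obj (denoiser x) < obj z" if "z \<noteq> denoiser x" for z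
  proof -
    have "0 < (norm (z - denoiser x))\<^sup>2 / (2 * (1 + L))" using that L_nonneg by simp
    then show ?thesis using min[of z] by linarith
  qed
  have "z \<in> Prox (\<lambda>x. ereal (regularizer x)) x \<longleftrightarrow> (\<forall>w. obj z \<le> obj w)" for z
    by (auto simp: Prox_def is_arg_min_def obj_def not_less)
  also have "(\<forall>w. obj z \<le> obj w) \<longleftrightarrow> z = denoiser x" for z
    using less by (metis less_le_not_le order_refl)
  finally show ?thesis by auto
qed

end

section \<open>Characterisation of the denoiser as a proximal map\<close>

theorem proposition5:
  fixes g h :: "real ^ 'n \<Rightarrow> real"
    and D :: "real ^ 'n \<Rightarrow> real ^ 'n"
    and L :: real and k :: nat
  assumes k: "k \<ge> 1"
    and g_Ck: "Ck_on (k + 1) g UNIV"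
    and g_lip: "L-lipschitz_on UNIV (grad g)"
    and L: "L < 1"
    and h: "h = (\<lambda>x. 1 / 2 * (norm x)\<^sup>2 - g x)"
    and D: "D = (\<lambda>x. x - grad g x)"
  shows "D = grad h \<and>
    (\<exists>(\<phi> :: real ^ 'n \<Rightarrow> ereal) (K :: real).
      (\<forall>x. \<phi> x \<noteq> -\<infinity>) \<and>
      weakly_convex (L / (L + 1)) \<phi> \<and>
      (\<forall>x. \<exists>!z. z \<in> Prox \<phi> x) \<and>
      (\<forall>x. Prox \<phi> x = {D x}) \<and>
      inj D \<and>
      open (range D) \<and>
      (\<forall>x\<in>range D.
         \<phi> x = ereal (g (inv D x) - 1 / 2 * (norm (inv D x - x))\<^sup>2 + K) \<and>
         \<phi> x = conjugate (\<lambda>u. ereal (h u)) x - ereal (1 / 2 * (norm x)\<^sup>2) + ereal K) \<and>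
      (\<forall>x. \<phi> x \<ge> ereal (g x + K)) \<and>
      (\<forall>x. D x = x \<longrightarrow> \<phi> x = ereal (g x + K)) \<and>
      Ck_on k (\<lambda>x. real_of_ereal (\<phi> x)) (range D) \<and>
      (\<forall>x\<in>range D.
         grad (\<lambda>y. real_of_ereal (\<phi> y)) x = inv D x - x \<and>
         inv D x - x = grad g (inv D x)) \<and>
      (L / (1 - L))-lipschitz_on (range D) (grad (\<lambda>y. real_of_ereal (\<phi> y))))"
proof -
  have g': "(g has_derivative frechet_derivative g (at x)) (at x)" for x
    using g_Ck by (intro Ck_on_Suc_has_derivative[of k g UNIV]) auto
  have gderiv: "GDERIV g x :> grad g x" for x
  proof -
    \<comment> \<open>The adjoint of a linear functional, evaluated at 1, is the vector that represents it.\<close>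
    have "linear (frechet_derivative g (at x))"
      using g' has_derivative_linear by blast
    then have "frechet_derivative g (at x) = (\<lambda>v. v \<bullet> adjoint (frechet_derivative g (at x)) 1)"
      by (simp add: adjoint_works)
    then have "GDERIV g x :> adjoint (frechet_derivative g (at x)) 1"
      using g'[of x] by (simp add: gderiv_def)
    then show ?thesis using grad_eqI by metis
  qed
  interpret contractive_gradient g "grad g" L
    by unfold_locales (use gderiv g_lip L in auto)
  have D_eq: "D = denoiser" and h_eq: "h = potential"
    by (auto simp: D h denoiser_def potential_def)
  have range: "range D = UNIV"
    using surj_denoiser by (simp add: D_eq)
  have grad_reg: "grad regularizer x = inv denoiser x - x" for x
    by (rule grad_eqI[OF gderiv_regularizer])
  have grad_Ck: "Ck_on k (\<lambda>x. grad g x $ i) UNIV" for i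
  proof -
    have "grad g x $ i = frechet_derivative g (at x) (axis i 1)" for x
      using fun_cong[OF frechet_derivative_at[OF gderiv[of x, unfolded gderiv_def]], of "axis i 1"]
      by (simp add: inner_axis')
    then show ?thesis using g_Ck by simp
  qed
  have D_Ck: "Ck_on k (\<lambda>y. denoiser y $ i) UNIV" for i
    using Ck_on_diff[OF open_UNIV Ck_on_inner_right[OF open_UNIV, of k "axis i 1"] grad_Ck[of i]]
    by (simp add: denoiser_def inner_axis)
  have D': "(denoiser has_derivative frechet_derivative denoiser (at y)) (at y)" for y
  proof -
    obtain m where "k = Suc m" using k by (cases k) auto
    then have "(\<lambda>y. denoiser y $ i) differentiable (at y)" for i
      using D_Ck[of i] by auto
    then have "denoiser differentiable (at y)"
      by (subst differentiable_componentwise_within) (auto simp: Basis_vec_def inner_axis)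
    then show ?thesis by (simp add: frechet_derivative_works)
  qed
  have E_Ck: "Ck_on k (\<lambda>x. inv denoiser x $ i) UNIV" for i
  proof (rule Ck_on_inverse_map[OF open_UNIV _ subset_UNIV denoiser_inv D' _ D_Ck])
    show "continuous_on UNIV (inv denoiser)"
      by (rule lipschitz_on_continuous_on[OF lipschitz_inv_denoiser])
    show "inj (frechet_derivative denoiser (at y))" for y
      by (rule inj_derivative_of_expanding_map[OF D', of "1 - L"])
        (use L denoiser_expanding in auto)
  qed
  \<comment> \<open>The gradient is of class k, so the regularizer is even of class k + 1.\<close>
  have reg_Ck: "Ck_on k regularizer UNIV"
  proof (rule Ck_on_SucD, rule Ck_on_SucI[OF open_UNIV])
    show "(regularizer has_derivative (\<lambda>v. v \<bullet> (inv denoiser x - x))) (at x)" for x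
      using gderiv_regularizer by (simp add: gderiv_def)
    have "Ck_on k (\<lambda>x. (\<Sum>i\<in>UNIV. v $ i * inv denoiser x $ i) - x \<bullet> v) UNIV" for v
      by (intro Ck_on_diff Ck_on_sum Ck_on_mult Ck_on_const Ck_on_inner_right E_Ck open_UNIV)
    moreover have "v \<bullet> (inv denoiser x - x) = (\<Sum>i\<in>UNIV. v $ i * inv denoiser x $ i) - x \<bullet> v"
      for v x
      by (simp add: inner_diff_right inner_vec_def[of v "inv denoiser x"] inner_commute[of x v])
    ultimately show "Ck_on k (\<lambda>x. v \<bullet> (inv denoiser x - x)) UNIV" for v
      by presburger
  qed
  have grad_reg_lip: "(L / (1 - L))-lipschitz_on UNIV (grad regularizer)"
  proof -
    have "grad regularizer = (\<lambda>x. grad g (inv denoiser x))"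
      by (rule ext) (simp add: grad_reg inv_denoiser_diff)
    then show ?thesis
      using lipschitz_on_compose2[OF lipschitz_inv_denoiser lipschitz_on_subset[OF lip subset_UNIV]]
      by (simp only: mult_1_right times_divide_eq_right)
  qed
  have fixed: "regularizer x = g x" if "denoiser x = x" for x
  proof -
    have "inv denoiser x = x" using inv_denoiser[of x] unfolding that .
    then show ?thesis by (simp add: regularizer_eq)
  qed
  show ?thesis
  proof (intro conjI exI[of _ "\<lambda>x. ereal (regularizer x)"] exI[of _ 0])
    show "D = grad h"
      unfolding D_eq h_eq by (rule ext) (rule grad_eqI[OF gderiv_potential, symmetric])
    show "\<forall>x\<in>range D.
        ereal (regularizer x) = ereal (g (inv D x) - 1 / 2 * (norm (inv D x - x))\<^sup>2 + 0) \<and>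
        ereal (regularizer x) =
          conjugate (\<lambda>u. ereal (h u)) x - ereal (1 / 2 * (norm x)\<^sup>2) + ereal 0"
      unfolding D_eq h_eq conjugate_potential
      by (intro ballI conjI) (simp add: regularizer_eq, simp add: regularizer_def)
    show "\<forall>x. Prox (\<lambda>x. ereal (regularizer x)) x = {D x}"
      by (simp add: Prox_regularizer D_eq)
    show "\<forall>x. \<exists>!z. z \<in> Prox (\<lambda>x. ereal (regularizer x)) x"
      by (simp add: Prox_regularizer)
    show "weakly_convex (L / (L + 1)) (\<lambda>x. ereal (regularizer x))"
      by (rule weakly_convex_regularizer)
    show "inj D"
      unfolding D_eq by (rule inj_denoiser)
    show "open (range D)"
      unfolding range by (rule open_UNIV)
    show "\<forall>x. ereal (g x + 0) \<le> ereal (regularizer x)"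
      using regularizer_ge by simp
    show "\<forall>x. D x = x \<longrightarrow> ereal (regularizer x) = ereal (g x + 0)"
      using fixed by (simp add: D_eq)
    show "Ck_on k (\<lambda>x. real_of_ereal (ereal (regularizer x))) (range D)"
      unfolding range real_of_ereal.simps by (rule reg_Ck)
    show "\<forall>x\<in>range D.
        grad (\<lambda>y. real_of_ereal (ereal (regularizer y))) x = inv D x - x \<and>
        inv D x - x = grad g (inv D x)"
      unfolding real_of_ereal.simps D_eq using grad_reg inv_denoiser_diff by blast
    show "(L / (1 - L))-lipschitz_on (range D)
        (grad (\<lambda>y. real_of_ereal (ereal (regularizer y))))"
      unfolding range real_of_ereal.simps by (rule grad_reg_lip)
  qed simp_all
qed

end
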